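(* The restriction of $I_M(v,\cdot)$ to singletons is given, for every $v\in\mathcal{F}_N$ and $i\in N$, by $$ I_M(v,\{i\})=\sum_{T\subseteq N\setminus\{i\}}\frac{6\,(n-t)!\,(t+1)!}{(n+2)!}\,[v(T\cup\{i\})-v(T)]. $$
   Context: Let $N=\{1,\ldots,n\}$, $n\geqslant 1$, and let $\mathcal{F}_N$ be the family of all set functions $v:2^N\to\mathbb{R}$. Cardinalities of subsets $S,T$ are denoted by $s,t$. The M\"obius transform of $v$ is $a(S)=\sum_{T\subseteq S}(-1)^{s-t}v(T)$. The mapping $I_M:\mathcal{F}_N\times 2^N\to\mathbb{R}$ is defined by $I_M(v,S)=\sum_{T\supseteq S}q_t^s\,a(T)$ (sum over $T\subseteq N$), where $q_t^s:=\binom{2s+1}{s+1}\big/\binom{s+t+1}{s+1}$ for $t\geqslant s\geqslant 0$. *)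

theory Defs
  imports Complex_Main
begin

text \<open>
  A set function on the subsets of \<open>N = {1..n}\<close> is represented by a total function
  \<open>v :: nat set \<Rightarrow> real\<close>; the definitions below only use its values on subsets of \<open>N\<close>
  when their set argument \<open>S\<close> is a subset of \<open>N\<close>.
\<close>

definition moebius :: "(nat set \<Rightarrow> real) \<Rightarrow> nat set \<Rightarrow> real" where
  "moebius v S = (\<Sum>T\<in>Pow S. (- 1) ^ (card S - card T) * v T)"

text \<open>The quantity \<open>q\<^sub>t\<^sup>s\<close>, meant for \<open>s \<le> t\<close>; the subscript \<open>t\<close> is the first argument.\<close>

definition q_coeff :: "nat \<Rightarrow> nat \<Rightarrow> real" where
  "q_coeff t s = real ((2 * s + 1) choose (s + 1)) / real ((s + t + 1) choose (s + 1))"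

definition I_M :: "nat \<Rightarrow> (nat set \<Rightarrow> real) \<Rightarrow> nat set \<Rightarrow> real" where
  "I_M n v S = (\<Sum>T | S \<subseteq> T \<and> T \<subseteq> {1..n}. q_coeff (card T) (card S) * moebius v T)"

end

theory Submission
  imports Defs
begin

text \<open>
  The Moebius transform of \<open>v\<close> at \<open>insert i U\<close>, with \<open>i \<notin> U\<close>, is the Moebius transform at \<open>U\<close>
  of the discrete derivative \<open>W \<mapsto> v (insert i W) - v W\<close>
  (\<open>moebius_insert\<close>).  Hence \<open>I_M n v {i}\<close> depends on \<open>v\<close> only through this derivative, and exchanging
  the order of summation turns it into a weighted sum of the derivative over all
  \<open>W \<subseteq> N - {i}\<close>.  Since \<open>q_coeff t 1 = 6 / ((t + 1) (t + 2))\<close>, the weight of \<open>W\<close> is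
  \<open>\<Sum> (-1)^(u - w) 6 / ((u + 2) (u + 3))\<close>, taken over \<open>W \<subseteq> U \<subseteq> N - {i}\<close>.
  Such an alternating sum over an interval of the subset lattice is an iterated finite difference of
  \<open>w \<mapsto> 1 / ((w + 2) (w + 3))\<close>.  Its closed form (\<open>alternating_sum_Pow_closed_form\<close>)
  is a Beta integral: with \<open>1 / ((w + 2) (w + 3)) = \<integral> x^(w + 1) (1 - x) dx\<close> over \<open>[0, 1]\<close> the sum
  becomes \<open>\<integral> x^(w + 1) (1 - x)^(a + 1) dx = (w + 1)! (a + 1)! / (w + a + 3)!\<close>, where
  \<open>a = \<bar>N - {i} - W\<bar>\<close>.  Below it is derived by induction on the interval instead of by integration.
\<close>

lemma sum_Pow_insert:
  fixes f :: "'a set \<Rightarrow> 'b::comm_monoid_add"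
  assumes "finite A" and "x \<notin> A"
  shows "(\<Sum>T\<in>Pow (insert x A). f T) = (\<Sum>T\<in>Pow A. f T + f (insert x T))"
proof -
  have "inj_on (insert x) (Pow A)"
    using assms(2) by (auto simp: inj_on_def insert_ident)
  moreover have "Pow A \<inter> insert x ` Pow A = {}"
    using assms(2) by auto
  ultimately show ?thesis
    using assms(1)
    by (simp add: Pow_insert sum.union_disjoint sum.reindex sum.distrib)
qed

lemma moebius_insert:
  assumes "finite U" and "i \<notin> U"
  shows "moebius v (insert i U) = moebius (\<lambda>W. v (insert i W) - v W) U"
proof -
  have "(- 1) ^ (card (insert i U) - card W) * v W
      + (- 1) ^ (card (insert i U) - card (insert i W)) * v (insert i W)
      = (- 1) ^ (card U - card W) * (v (insert i W) - v W)" if "W \<in> Pow U" for W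
  proof -
    have "finite W" "i \<notin> W" and "card W \<le> card U"
      using that assms by (auto intro: finite_subset card_mono)
    then show ?thesis
      using assms by (simp add: Suc_diff_le algebra_simps)
  qed
  then show ?thesis
    using assms unfolding moebius_def by (simp add: sum_Pow_insert)
qed

lemma q_coeff_one: "q_coeff t 1 = 6 / (real (t + 1) * real (t + 2))"
proof -
  have "2 * ((t + 2) choose 2) = (t + 1) * (t + 2)"
    by (simp add: choose_two algebra_simps)
  then have "2 * real ((t + 2) choose 2) = real (t + 1) * real (t + 2)"
    by (metis of_nat_mult of_nat_numeral)
  then have "real ((t + 2) choose 2) = real (t + 1) * real (t + 2) / 2"
    by simp
  moreover have "(3 choose 2 :: nat) = 3"
    by (simp add: choose_two)
  moreover have "q_coeff t 1 = real (3 choose 2) / real ((t + 2) choose 2)"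
    by (simp add: q_coeff_def numeral_2_eq_2 numeral_3_eq_3)
  ultimately show ?thesis
    by (simp only:) simp
qed

text \<open>
  Splitting the subsets of \<open>insert x A\<close> according to whether they contain \<open>x\<close> gives the difference of
  the sums over \<open>Pow A\<close> for \<open>w\<close> and for \<open>w + 1\<close>; so \<open>w\<close> has to vary in the induction.  The
  right-hand side obeys the same recursion, because
  \<open>(w + a + 4) - (w + 2) = a + 2\<close> for \<open>a = card A\<close>.
\<close>

lemma alternating_sum_Pow_closed_form:
  assumes "finite A"
  shows "(\<Sum>V\<in>Pow A. (- 1) ^ card V / (real (w + card V + 2) * real (w + card V + 3)))
    = fact (card A + 1) * fact (w + 1) / (fact (w + card A + 3) :: real)"
  using assms
proof (induction A arbitrary: w)
  case empty
  have "fact (w + 3) = real (w + 3) * (real (w + 2) * fact (w + 1))"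
    by (simp add: numeral_3_eq_3)
  then show ?case
    by simp
next
  case (insert x A)
  let ?f = "\<lambda>w V. (- 1) ^ card V / (real (w + card V + 2) * real (w + card V + 3))"
  let ?a = "card A"
  have step: "?f w (insert x V) = - ?f (w + 1) V" if "V \<in> Pow A" for V
  proof -
    have "card (insert x V) = card V + 1"
      using that insert.hyps by (subst card_insert_disjoint) (auto intro: finite_subset)
    then show ?thesis
      by (simp add: algebra_simps)
  qed
  have "(\<Sum>V\<in>Pow (insert x A). ?f w V) = (\<Sum>V\<in>Pow A. ?f w V - ?f (w + 1) V)"
    unfolding sum_Pow_insert[OF insert.hyps] by (rule sum.cong) (simp_all only: step)
  also have "\<dots> = (\<Sum>V\<in>Pow A. ?f w V) - (\<Sum>V\<in>Pow A. ?f (w + 1) V)"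
    by (rule sum_subtractf)
  also have "\<dots> = fact (?a + 1) * fact (w + 1) / fact (w + ?a + 3)
      - fact (?a + 1) * fact (w + 1 + 1) / fact (w + 1 + ?a + 3)"
    by (simp only: insert.IH)
  also have "\<dots> = fact (?a + 2) * fact (w + 1) / fact (w + ?a + 4)"
  proof -
    have w: "fact (w + 1 + 1) = (real w + 2) * fact (w + 1)"
      using fact_Suc[of "w + 1", where 'a = real] by (simp add: algebra_simps)
    have a: "fact (?a + 2) = (real ?a + 2) * fact (?a + 1)"
      using fact_Suc[of "?a + 1", where 'a = real] by (simp add: algebra_simps)
    have wa: "fact (w + ?a + 4) = (real w + real ?a + 4) * fact (w + ?a + 3)"
      using fact_Suc[of "w + ?a + 3", where 'a = real] by (simp add: algebra_simps)
    have e: "w + 1 + ?a + 3 = w + ?a + 4"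
      by simp
    have alg: "p * q / r - p * (c * q) / (d * r) = (d - c) * p * q / (d * r)"
      if "d > 0" "r > 0" for p q r c d :: real
      using that by (simp add: field_simps)
    show ?thesis
      unfolding e w a wa by (subst alg) simp_all
  qed
  finally show ?case
    using insert.hyps by (simp add: add.commute add.left_commute)
qed

text \<open>
  The supersets of \<open>W\<close> inside \<open>M\<close> are parametrised by their part in \<open>M - W\<close>, after which the sum
  over an interval of sets is a sum over a power set.
\<close>

lemma sum_moebius_exchange:
  fixes c :: "nat \<Rightarrow> real"
  assumes "finite M"
  shows "(\<Sum>U\<in>Pow M. c (card U) * moebius d U)
    = (\<Sum>W\<in>Pow M. (\<Sum>V\<in>Pow (M - W). (- 1) ^ card V * c (card W + card V)) * d W)"
proof -
  let ?g = "\<lambda>U W. c (card U) * ((- 1) ^ (card U - card W) * d W)"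
  have "(\<Sum>U\<in>Pow M. c (card U) * moebius d U) = (\<Sum>U\<in>Pow M. \<Sum>W | W \<in> Pow M \<and> W \<subseteq> U. ?g U W)"
    unfolding moebius_def sum_distrib_left
    by (intro sum.cong) auto
  also have "\<dots> = (\<Sum>W\<in>Pow M. \<Sum>U | U \<in> Pow M \<and> W \<subseteq> U. ?g U W)"
    using assms by (intro sum.swap_restrict) auto
  also have "\<dots> = (\<Sum>W\<in>Pow M. (\<Sum>V\<in>Pow (M - W). (- 1) ^ card V * c (card W + card V)) * d W)"
  proof (rule sum.cong[OF refl])
    fix W assume W: "W \<in> Pow M"
    have "(\<Sum>U | U \<in> Pow M \<and> W \<subseteq> U. ?g U W)
        = (\<Sum>V\<in>Pow (M - W). (- 1) ^ card V * c (card W + card V) * d W)"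
    proof (rule sum.reindex_bij_witness[where i = "\<lambda>V. W \<union> V" and j = "\<lambda>U. U - W"])
      fix U assume U: "U \<in> {U. U \<in> Pow M \<and> W \<subseteq> U}"
      then have "finite U" "finite W"
        using W assms by (auto intro: finite_subset)
      then have "card (U - W) = card U - card W" "card W \<le> card U"
        using U by (auto simp: card_Diff_subset card_mono)
      then show "(- 1) ^ card (U - W) * c (card W + card (U - W)) * d W = ?g U W"
        by simp
    qed (use W in auto)
    then show "(\<Sum>U | U \<in> Pow M \<and> W \<subseteq> U. ?g U W)
        = (\<Sum>V\<in>Pow (M - W). (- 1) ^ card V * c (card W + card V)) * d W"
      by (simp add: sum_distrib_right)
  qed
  finally show ?thesis .
qed

theorem corollary19:
  fixes n i :: nat and v :: "nat set \<Rightarrow> real"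
  assumes "n \<ge> 1" and "i \<in> {1..n}"
  shows "I_M n v {i} =
    (\<Sum>T\<in>Pow ({1..n} - {i}).
       6 * fact (n - card T) * fact (card T + 1) / fact (n + 2) * (v (T \<union> {i}) - v T))"
proof -
  define M where "M = {1..n} - {i}"
  define d where "d = (\<lambda>W. v (insert i W) - v W)"
  \<comment> \<open>The weight \<open>q_coeff t 1\<close> as a function of \<open>u = t - 1\<close>, the size of \<open>T - {i}\<close>.\<close>
  define c where "c = (\<lambda>u. 6 / (real (u + 2) * real (u + 3)))"
  have M: "finite M" "i \<notin> M" "card M + 1 = n"
    using assms by (auto simp: M_def)
  have "I_M n v {i} = (\<Sum>U\<in>Pow M. q_coeff (card (insert i U)) 1 * moebius v (insert i U))"
    unfolding I_M_def
    by (rule sum.reindex_bij_witness[where i = "insert i" and j = "\<lambda>T. T - {i}"])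
      (use assms in \<open>auto simp: M_def insert_absorb\<close>)
  also have "\<dots> = (\<Sum>U\<in>Pow M. c (card U) * moebius d U)"
  proof (rule sum.cong[OF refl])
    fix U assume "U \<in> Pow M"
    then have "finite U" "i \<notin> U"
      using M by (auto intro: finite_subset)
    then show "q_coeff (card (insert i U)) 1 * moebius v (insert i U) = c (card U) * moebius d U"
      by (simp add: q_coeff_one[unfolded One_nat_def] moebius_insert c_def d_def algebra_simps)
  qed
  also have "\<dots> = (\<Sum>W\<in>Pow M. (\<Sum>V\<in>Pow (M - W). (- 1) ^ card V * c (card W + card V)) * d W)"
    using M(1) by (rule sum_moebius_exchange)
  also have "\<dots> = (\<Sum>W\<in>Pow M.
      6 * fact (n - card W) * fact (card W + 1) / fact (n + 2) * (v (W \<union> {i}) - v W))"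
  proof (rule sum.cong[OF refl])
    fix W assume "W \<in> Pow M"
    then have "card (M - W) = card M - card W" "card W \<le> card M"
      using M(1) by (auto simp: card_Diff_subset finite_subset card_mono)
    then have size: "card (M - W) + 1 = n - card W" "card W + card (M - W) + 3 = n + 2"
      using M(3) by auto
    have "(\<Sum>V\<in>Pow (M - W). (- 1) ^ card V * c (card W + card V))
        = 6 * (\<Sum>V\<in>Pow (M - W). (- 1) ^ card V
            / (real (card W + card V + 2) * real (card W + card V + 3)))"
      by (simp add: c_def sum_distrib_left mult.commute)
    also have "\<dots> = 6 * (fact (n - card W) * fact (card W + 1) / fact (n + 2))"
      using alternating_sum_Pow_closed_form[of "M - W" "card W"] M(1)
      unfolding size by simp
    finally show "(\<Sum>V\<in>Pow (M - W). (- 1) ^ card V * c (card W + card V)) * d W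
        = 6 * fact (n - card W) * fact (card W + 1) / fact (n + 2) * (v (W \<union> {i}) - v W)"
      by (simp add: d_def)
  qed
  finally show ?thesis
    by (simp only: M_def)
qed

end
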